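(* Let $c$ be a superattracting parameter. Fix $N\in\mathbb{N}$ and $k\in\mathbb{N}$, and let $p_i\in\{0,1,\dots,k-1\}$ for $i=1,\dots,N$. Put $\zeta_k=e^{2\pi i/k}$ and $c_i=c+\rho\,\zeta_k^{p_i}$, where $\rho$ is a complex variable. Let $\Delta(\rho)$ be the discriminant, with respect to the variable $z$, of the polynomial equation $f_{c_N}\circ\cdots\circ f_{c_1}(z)-z=0$; it is a polynomial in $\rho$. If $\Delta(\rho_0)=0$ for some $\rho_0\in\mathbb{C}$, then $r_{\mathrm{bif}}(c)\le|\rho_0|$.
   Context: $f_c(z)=z^2+c$, extended to $\widehat{\mathbb{C}}$ by $f_c(\infty)=\infty$. A parameter $c$ is superattracting if $f_{c}^{\circ p}(0)=0$ for some $p\in\mathbb{N}$. For $c\in\mathbb{C}$, $r\ge0$, $G_{c,r}$ is the semigroup under composition generated by $\{f_{c'}:|c'-c|\le r\}$. A minimal set of a polynomial semigroup $G$ is a minimal element, with respect to inclusion, of the family of non-empty compact $L\subset\widehat{\mathbb{C}}$ with $g(L)\subset L$ for all $g\in G$; it is planar if $\infty\notin L$. The bifurcation radius $r_{\mathrm{bif}}(c)$ is the supremum of those $r\ge0$ for which $G_{c,r}$ has a planar minimal set (equivalently the infimum of those $r\ge0$ for which $G_{c,r}$ has no planar minimal set); by prior work this value is attained and $G_{c,r}$ has a planar minimal set iff $r\le r_{\mathrm{bif}}(c)$. *)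

theory Defs
  imports "HOL-Analysis.Analysis" "Subresultants.Resultant_Prelim"
begin

definition quad :: "complex \<Rightarrow> complex \<Rightarrow> complex" where
  "quad c z = z ^ 2 + c"

definition superattracting :: "complex \<Rightarrow> bool" where
  "superattracting c \<longleftrightarrow> (\<exists>p::nat. p \<ge> 1 \<and> (quad c ^^ p) 0 = 0)"

inductive_set semigroup_G :: "complex \<Rightarrow> real \<Rightarrow> (complex \<Rightarrow> complex) set"
  for c :: complex and r :: real where
  gen: "cmod (c' - c) \<le> r \<Longrightarrow> quad c' \<in> semigroup_G c r"
| comp: "g \<in> semigroup_G c r \<Longrightarrow> h \<in> semigroup_G c r \<Longrightarrow> g \<circ> h \<in> semigroup_G c r"

definition G_invariant :: "complex \<Rightarrow> real \<Rightarrow> complex set \<Rightarrow> bool" where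
  "G_invariant c r L \<longleftrightarrow> (\<forall>g\<in>semigroup_G c r. g ` L \<subseteq> L)"

text \<open>A planar minimal set of G_{c,r}: a nonempty compact invariant L \<subseteq> \<complex> (i.e. not
  containing \<infinity>) that is minimal w.r.t. inclusion among nonempty compact invariant
  subsets of the Riemann sphere.  Any such subset of L avoids \<infinity>, hence is a compact
  subset of \<complex>.\<close>
definition planar_minimal_set :: "complex \<Rightarrow> real \<Rightarrow> complex set \<Rightarrow> bool" where
  "planar_minimal_set c r L \<longleftrightarrow>
     L \<noteq> {} \<and> compact L \<and> G_invariant c r L \<and>
     (\<forall>K. K \<noteq> {} \<and> compact K \<and> G_invariant c r K \<and> K \<subseteq> L \<longrightarrow> K = L)"

definition has_planar_minimal_set :: "complex \<Rightarrow> real \<Rightarrow> bool" where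
  "has_planar_minimal_set c r \<longleftrightarrow> (\<exists>L. planar_minimal_set c r L)"

definition r_bif :: "complex \<Rightarrow> ereal" where
  "r_bif c = Sup {ereal r | r. r \<ge> 0 \<and> has_planar_minimal_set c r}"

definition comp_poly :: "complex list \<Rightarrow> complex poly" where
  "comp_poly cs = foldl (\<lambda>Q a. Q ^ 2 + [:a:]) [:0, 1:] cs"

definition discriminant :: "complex poly \<Rightarrow> complex" where
  "discriminant P = (-1) ^ (degree P * (degree P - 1) div 2)
      * resultant P (pderiv P) / lead_coeff P"

end

theory Submission
  imports Defs "HOL-Complex_Analysis.Cauchy_Integral_Formula"
    "HOL-Computational_Algebra.Fundamental_Theorem_Algebra" "HOL-Computational_Algebra.Field_as_Ring"
    "Subresultants.Subresultant_Gcd"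
begin

text \<open>A zero of the discriminant yields a periodic point \<open>z\<close> of multiplier 1 for a composition of
  generators whose parameters have distance \<open>|\<rho>0|\<close> from \<open>c\<close>. Suppose \<open>L\<close> is a nonempty compact
  invariant set of \<open>G_{c,r}\<close> with \<open>r > |\<rho>0|\<close>. All contradictions come from Cauchy's estimate applied
  to compositions whose parameters depend holomorphically on the starting point: as the parameters
  have room to move, derivatives along orbits in \<open>L\<close> tend to 0. If \<open>0\<close> were not in \<open>L\<close>, the
  superattracting cycle would stay away from \<open>L\<close>, and inverse branches avoiding that cycle would
  bound the derivatives from below. So \<open>0 \<in> L\<close>. Then \<open>z \<in> L\<close> is impossible because its multiplier
  is 1, and if \<open>z \<notin> L\<close>, then all critical values lie in \<open>L\<close>, so inverse branches exist on a disc
  around \<open>z\<close>, stay bounded, and the same perturbation shows that their derivatives tend to 0.\<close>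

section \<open>Discriminants, double roots and multiplier one\<close>

lemma resultant_pderiv_zero_imp_double_root:
  fixes P :: "complex poly"
  assumes "resultant P (pderiv P) = 0"
  obtains z where "poly P z = 0" "poly (pderiv P) z = 0"
proof -
  have "degree (gcd P (pderiv P)) \<noteq> 0"
    using assms by (simp add: resultant_0_gcd)
  then have "\<not> constant (poly (gcd P (pderiv P)))"
    by (simp add: constant_degree)
  then obtain z where "poly (gcd P (pderiv P)) z = 0"
    using fundamental_theorem_of_algebra by blast
  then have "[:- z, 1:] dvd gcd P (pderiv P)"
    by (simp add: poly_eq_0_iff_dvd)
  then have "[:- z, 1:] dvd P" "[:- z, 1:] dvd pderiv P"
    by simp_all
  then show thesis
    using that by (simp add: poly_eq_0_iff_dvd)
qed

text \<open>An infinite parameter sequence instead of a list lets a finite composition be continued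
  periodically, so that orbits can be followed for any number of periods.\<close>

primrec quad_orbit :: "(nat \<Rightarrow> complex) \<Rightarrow> complex \<Rightarrow> nat \<Rightarrow> complex" where
  "quad_orbit \<gamma> z 0 = z"
| "quad_orbit \<gamma> z (Suc n) = (quad_orbit \<gamma> z n)\<^sup>2 + \<gamma> n"

lemma poly_comp_poly: "poly (comp_poly (map \<gamma> [0..<n])) z = quad_orbit \<gamma> z n"
  by (induction n) (simp_all add: comp_poly_def)

lemma poly_pderiv_comp_poly:
  "poly (pderiv (comp_poly (map \<gamma> [0..<n]))) z = (\<Prod>i<n. 2 * quad_orbit \<gamma> z i)"
proof (induction n)
  case (Suc n)
  have "comp_poly (map \<gamma> [0..<Suc n]) = (comp_poly (map \<gamma> [0..<n]))\<^sup>2 + [:\<gamma> n:]"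
    by (simp add: comp_poly_def)
  with Suc show ?case
    by (simp add: poly_comp_poly power2_eq_square pderiv_add pderiv_mult pderiv_pCons)
qed (simp add: comp_poly_def pderiv_pCons)

lemma degree_comp_poly: "degree (comp_poly cs) = 2 ^ length cs"
proof (induction cs rule: rev_induct)
  case (snoc a cs)
  have "comp_poly (cs @ [a]) = (comp_poly cs)\<^sup>2 + [:a:]"
    by (simp add: comp_poly_def)
  moreover have "comp_poly cs \<noteq> 0"
    using snoc by (metis degree_0 power_not_zero zero_neq_numeral)
  then have "degree ((comp_poly cs)\<^sup>2) = 2 * 2 ^ length cs"
    using snoc by (simp add: degree_power_eq)
  ultimately show ?case
    by (simp add: degree_add_eq_left)
qed (simp add: comp_poly_def)

text \<open>Subtracting z cannot cancel a polynomial of degree above 1, so the resultant itself must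
  vanish. A double root is then a fixed point of the composition at which the derivative, by the
  chain rule the product along the orbit, equals 1.\<close>

lemma comp_poly_discriminant_zero:
  assumes "n \<ge> 1" "discriminant (comp_poly (map \<gamma> [0..<n]) - [:0, 1:]) = 0"
  obtains z where "quad_orbit \<gamma> z n = z" "(\<Prod>i<n. 2 * quad_orbit \<gamma> z i) = 1"
proof -
  let ?Q = "comp_poly (map \<gamma> [0..<n])"
  have "degree ?Q > 1"
    using assms(1) one_less_power[of "2::nat" n] by (simp add: degree_comp_poly)
  then have "?Q - [:0, 1:] \<noteq> 0"
    by auto
  then have "lead_coeff (?Q - [:0, 1:]) \<noteq> 0"
    by (simp only: leading_coeff_0_iff not_False_eq_True)
  then have "resultant (?Q - [:0, 1:]) (pderiv (?Q - [:0, 1:])) = 0"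
    using assms(2) unfolding discriminant_def
    by (metis divide_eq_0_iff mult_eq_0_iff neg_equal_0_iff_equal power_not_zero zero_neq_one)
  then obtain z where "poly (?Q - [:0, 1:]) z = 0" "poly (pderiv (?Q - [:0, 1:])) z = 0"
    by (rule resultant_pderiv_zero_imp_double_root)
  then show thesis
    using that[of z]
    by (simp add: poly_comp_poly poly_pderiv_comp_poly pderiv_diff pderiv_pCons)
qed

section \<open>Periodic orbits and an affine recurrence\<close>

lemma orbit_periodic:
  assumes per: "\<And>i. \<gamma> (i + n) = \<gamma> i" and "quad_orbit \<gamma> z n = z"
  shows "quad_orbit \<gamma> z (i + n) = quad_orbit \<gamma> z i"
  using assms by (induction i) simp_all

lemma prod_periodic:
  fixes g :: "nat \<Rightarrow> 'a::comm_monoid_mult"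
  assumes "\<And>i. g (i + n) = g i"
  shows "(\<Prod>i<m * n. g i) = (\<Prod>i<n. g i) ^ m"
proof (induction m)
  case (Suc m)
  have shift: "g (i + m * n) = g i" for i
  proof (induction m)
    case (Suc m)
    then show ?case
      using assms[of "i + m * n"] by (simp add: algebra_simps)
  qed simp
  have "(\<Prod>i<m * n + j. g i) = (\<Prod>i<m * n. g i) * (\<Prod>i<j. g (i + m * n))" for j
    by (induction j) (simp_all add: mult.assoc add.commute)
  from this[of n] show ?case
    using Suc by (simp add: shift algebra_simps)
qed simp

text \<open>The sequence \<open>a\<close> models derivatives of perturbed compositions and the
  product the unperturbed multiplier. Since every product is at most \<open>M\<close>, each summand
  \<open>\<kappa>\<close> is worth at least \<open>\<kappa> / M\<close> times the current product,
  and these gains add up linearly in \<open>n\<close>.\<close>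

lemma affine_recurrence_bound:
  fixes a m :: "nat \<Rightarrow> real"
  assumes "a 0 = 1" and step: "\<And>i. i < n \<Longrightarrow> a (Suc i) \<ge> m i * a i + \<kappa>"
    and bound: "\<And>i. i \<le> n \<Longrightarrow> a i \<le> M"
    and m: "\<And>i. i < n \<Longrightarrow> m i \<ge> 0" and "\<kappa> \<ge> 0"
  shows "(\<Prod>i<n. m i) * (1 + \<kappa> * n / M) \<le> a n"
proof -
  have M: "M \<ge> 1"
    using bound[of 0] assms(1) by simp
  have "(\<Prod>i<j. m i) * (1 + \<kappa> * j / M) \<le> a j" if "j \<le> n" for j
    using that
  proof (induction j)
    case (Suc j)
    let ?\<pi> = "\<Prod>i<j. m i"
    have mj: "m j \<ge> 0" and pi: "?\<pi> \<ge> 0"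
      using Suc.prems m by (auto intro!: prod_nonneg)
    have IH: "?\<pi> * (1 + \<kappa> * j / M) \<le> a j"
      using Suc by simp
    have *: "m j * ?\<pi> * (1 + \<kappa> * j / M) \<le> m j * a j"
      using mult_left_mono[OF IH mj] by (simp add: algebra_simps)
    \<comment> \<open>The product up to \<open>Suc j\<close> is bounded by \<open>M\<close>, which
      allows \<open>\<kappa>\<close> to be replaced by a multiple of that product.\<close>
    have "m j * ?\<pi> \<le> m j * ?\<pi> * (1 + \<kappa> * j / M)"
      using mj pi M \<open>\<kappa> \<ge> 0\<close> by (simp add: distrib_left)
    also have "\<dots> \<le> m j * a j"
      by (rule *)
    also have "\<dots> \<le> M"
      using step[of j] bound[of "Suc j"] Suc.prems \<open>\<kappa> \<ge> 0\<close> by simp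
    finally have "m j * ?\<pi> * (\<kappa> / M) \<le> M * (\<kappa> / M)"
      using M \<open>\<kappa> \<ge> 0\<close> by (intro mult_right_mono) auto
    then have "m j * ?\<pi> * (\<kappa> / M) \<le> \<kappa>"
      using M by simp
    with * have "m j * ?\<pi> * (1 + \<kappa> * j / M) + m j * ?\<pi> * (\<kappa> / M) \<le> a (Suc j)"
      using step[of j] Suc.prems by simp
    then show ?case
      by (simp add: algebra_simps add_divide_distrib)
  qed (use assms in simp)
  then show ?thesis by simp
qed

section \<open>Cauchy estimates along forward and backward orbits\<close>

text \<open>Cauchy's inequality on the disc of half the radius, whose closure lies in the open ball;
  hence the factor 2.\<close>

lemma deriv_bound_ball:
  assumes "h holomorphic_on ball z \<epsilon>" "\<epsilon> > 0" "\<And>\<zeta>. \<zeta> \<in> ball z \<epsilon> \<Longrightarrow> cmod (h \<zeta>) \<le> R"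
    and "(h has_field_derivative d) (at z)"
  shows "cmod d \<le> 2 * R / \<epsilon>"
proof -
  have sub: "cball z (\<epsilon> / 2) \<subseteq> ball z \<epsilon>" "ball z (\<epsilon> / 2) \<subseteq> ball z \<epsilon>"
    using assms(2) by auto
  have "cmod ((deriv ^^ 1) h z) \<le> fact 1 * R / (\<epsilon> / 2) ^ 1"
  proof (rule Cauchy_inequality)
    show "h holomorphic_on ball z (\<epsilon> / 2)"
      using assms(1) sub(2) holomorphic_on_subset by blast
    show "continuous_on (cball z (\<epsilon> / 2)) h"
      using assms(1) sub(1) holomorphic_on_imp_continuous_on holomorphic_on_subset by blast
    show "cmod (h x) \<le> R" if "cmod (z - x) = \<epsilon> / 2" for x
      using assms(2,3) that by (simp add: dist_norm)
  qed (use assms(2) in simp)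
  then show ?thesis
    using DERIV_imp_deriv[OF assms(4)] by (simp add: algebra_simps)
qed

text \<open>Letting the parameters move holomorphically with the starting point, as
  \<open>\<gamma> i + e i * (\<zeta> - z)\<close> with \<open>e i\<close> of modulus \<open>s / \<epsilon>\<close>, the derivative at \<open>z\<close> picks up
  an extra summand at every step; the phases of \<open>e i\<close> are chosen so that moduli add up.\<close>

lemma forward_family:
  fixes \<gamma> :: "nat \<Rightarrow> complex" and L :: "complex set"
  assumes "ball z \<epsilon> \<subseteq> L" "\<epsilon> > 0" "s \<ge> 0"
    and inv: "\<And>i c' x. cmod (c' - \<gamma> i) \<le> s \<Longrightarrow> x \<in> L \<Longrightarrow> x\<^sup>2 + c' \<in> L"
    and a: "a 0 = 1" "\<And>i. a (Suc i) = 2 * cmod (quad_orbit \<gamma> z i) * a i + s / \<epsilon>"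
  shows "\<exists>h d. h holomorphic_on ball z \<epsilon> \<and> h ` ball z \<epsilon> \<subseteq> L \<and> h z = quad_orbit \<gamma> z n \<and>
           (h has_field_derivative d) (at z) \<and> cmod d = a n"
proof (induction n)
  case 0
  show ?case
    using assms(1) a by (intro exI[of _ "\<lambda>x. x"] exI[of _ 1]) auto
next
  case (Suc n)
  then obtain h d where h: "h holomorphic_on ball z \<epsilon>" "h ` ball z \<epsilon> \<subseteq> L" "h z = quad_orbit \<gamma> z n"
      "(h has_field_derivative d) (at z)" "cmod d = a n"
    by blast
  define D where "D = 2 * h z * d"
  \<comment> \<open>As \<open>sgn 0 = 0\<close>, the default 1 keeps the modulus of \<open>e\<close>
    equal to \<open>s / \<epsilon>\<close> at a vanishing derivative.\<close>
  define e where "e = of_real (s / \<epsilon>) * (if D = 0 then 1 else sgn D)"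
  define g where "g = (\<lambda>\<zeta>. (h \<zeta>)\<^sup>2 + (\<gamma> n + e * (\<zeta> - z)))"
  have e: "cmod e = s / \<epsilon>"
    using assms(2,3) by (simp add: e_def norm_mult norm_divide norm_sgn)
  have De: "cmod (D + e) = cmod D + s / \<epsilon>"
  proof (cases "D = 0")
    case False
    then have "D + e = of_real (cmod D + s / \<epsilon>) * sgn D"
      by (simp add: e_def sgn_eq field_simps)
    then have "cmod (D + e) = \<bar>cmod D + s / \<epsilon>\<bar>"
      using False by (simp only: norm_mult norm_of_real norm_sgn) simp
    then show ?thesis
      using assms(2,3) by simp
  qed (use e in simp)
  have "g holomorphic_on ball z \<epsilon>"
    unfolding g_def by (intro holomorphic_intros h)
  moreover have "g ` ball z \<epsilon> \<subseteq> L"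
  proof (clarify)
    fix \<zeta> assume \<zeta>: "\<zeta> \<in> ball z \<epsilon>"
    have "cmod (e * (\<zeta> - z)) \<le> s / \<epsilon> * \<epsilon>"
      unfolding norm_mult e using \<zeta> assms(2,3)
      by (intro mult_left_mono) (auto simp: dist_norm norm_minus_commute)
    then show "g \<zeta> \<in> L"
      unfolding g_def using \<zeta> h(2) assms(2) by (intro inv[of _ n]) auto
  qed
  moreover have "g z = quad_orbit \<gamma> z (Suc n)"
    by (simp add: g_def h(3))
  moreover have "(g has_field_derivative D + e) (at z)"
    unfolding g_def D_def by (auto intro!: derivative_eq_intros h(4))
  moreover have "cmod (D + e) = a (Suc n)"
    unfolding De a(2) by (simp add: D_def norm_mult h)
  ultimately show ?case
    by blast
qed

text \<open>The perturbed derivatives \<open>a i\<close> belong to maps of a fixed disc into the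
  bounded set \<open>L\<close>, so they are uniformly bounded. Through the affine recurrence, this
  forces the multiplier to decay at least like \<open>1 / n\<close> when
  \<open>s > 0\<close>.\<close>

lemma forward_multiplier_bound:
  fixes \<gamma> :: "nat \<Rightarrow> complex" and L :: "complex set"
  assumes "ball z \<epsilon> \<subseteq> L" "\<epsilon> > 0" "s \<ge> 0"
    and inv: "\<And>i c' x. cmod (c' - \<gamma> i) \<le> s \<Longrightarrow> x \<in> L \<Longrightarrow> x\<^sup>2 + c' \<in> L"
    and bound: "\<And>x. x \<in> L \<Longrightarrow> cmod x \<le> R"
  shows "(\<Prod>i<n. 2 * cmod (quad_orbit \<gamma> z i)) * (1 + s / \<epsilon> * n / (2 * R / \<epsilon>)) \<le> 2 * R / \<epsilon>"
proof -
  define a where "a = rec_nat 1 (\<lambda>i y. 2 * cmod (quad_orbit \<gamma> z i) * y + s / \<epsilon>)"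
  have a: "a 0 = 1" "\<And>i. a (Suc i) = 2 * cmod (quad_orbit \<gamma> z i) * a i + s / \<epsilon>"
    by (simp_all add: a_def)
  have aM: "a i \<le> 2 * R / \<epsilon>" for i
  proof -
    obtain h d where h: "h holomorphic_on ball z \<epsilon>" "h ` ball z \<epsilon> \<subseteq> L"
      "(h has_field_derivative d) (at z)" "cmod d = a i"
      using forward_family[of z \<epsilon> L s \<gamma> a i] assms(1-3) inv a by blast
    then show ?thesis
      using deriv_bound_ball[OF h(1) assms(2) _ h(3), of R] bound by (auto simp: image_subset_iff)
  qed
  have "(\<Prod>i<n. 2 * cmod (quad_orbit \<gamma> z i)) * (1 + s / \<epsilon> * n / (2 * R / \<epsilon>)) \<le> a n"
    using assms(2,3) by (intro affine_recurrence_bound) (auto simp: a aM)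
  with aM[of n] show ?thesis
    by simp
qed

text \<open>The same device for inverse branches. Branches exist because the critical value of every map
  used lies in the forward invariant set \<open>X\<close>, which backward orbits starting off \<open>X\<close> never meet.\<close>

lemma backward_family:
  fixes \<gamma> w :: "nat \<Rightarrow> complex" and X :: "complex set"
  assumes disj: "ball (w 0) \<epsilon> \<inter> X = {}" and "\<epsilon> > 0" "s \<ge> 0"
    and w: "\<And>i. i < n \<Longrightarrow> w i = (w (Suc i))\<^sup>2 + \<gamma> i"
    and crit: "\<And>i c'. i < n \<Longrightarrow> cmod (c' - \<gamma> i) \<le> s \<Longrightarrow> c' \<in> X"
    and inv: "\<And>i c' x. i < n \<Longrightarrow> cmod (c' - \<gamma> i) \<le> s \<Longrightarrow> x \<in> X \<Longrightarrow> x\<^sup>2 + c' \<in> X"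
    and R: "R \<ge> 2" "cmod (w 0) + \<epsilon> \<le> R" "\<And>i. i < n \<Longrightarrow> cmod (\<gamma> i) + s \<le> R"
    and b: "b 0 = 1" "\<And>i. b (Suc i) = (b i + s / \<epsilon>) / (2 * cmod (w (Suc i)))"
  shows "j \<le> n \<Longrightarrow> \<exists>h d. h holomorphic_on ball (w 0) \<epsilon> \<and> h ` ball (w 0) \<epsilon> \<subseteq> cball 0 R - X \<and>
           h (w 0) = w j \<and> (h has_field_derivative d) (at (w 0)) \<and> cmod d = b j"
proof (induction j)
  case 0
  have "cmod x \<le> R" if "x \<in> ball (w 0) \<epsilon>" for x
    using that R(2) norm_triangle_sub[of x "w 0"] by (simp add: dist_norm norm_minus_commute)
  with disj show ?case
    using b by (intro exI[of _ "\<lambda>x. x"] exI[of _ 1]) auto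
next
  case (Suc j)
  let ?B = "ball (w 0) \<epsilon>"
  have j: "j < n"
    using Suc.prems by simp
  from Suc obtain h d where h: "h holomorphic_on ?B" "h ` ?B \<subseteq> cball 0 R - X" "h (w 0) = w j"
      "(h has_field_derivative d) (at (w 0))" "cmod d = b j"
    by auto
  \<comment> \<open>The next branch is a square root of \<open>h - q\<close>, whose derivative at
    \<open>w 0\<close> is \<open>d - e\<close>; the minus sign makes the moduli add.\<close>
  define e where "e = - of_real (s / \<epsilon>) * (if d = 0 then 1 else sgn d)"
  define q where "q = (\<lambda>\<zeta>. \<gamma> j + e * (\<zeta> - w 0))"
  have e: "cmod e = s / \<epsilon>"
    using assms(2,3) by (simp add: e_def norm_mult norm_divide norm_sgn)
  have de: "cmod (d - e) = cmod d + s / \<epsilon>"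
  proof (cases "d = 0")
    case False
    then have "d - e = of_real (cmod d + s / \<epsilon>) * sgn d"
      by (simp add: e_def sgn_eq field_simps)
    then have "cmod (d - e) = \<bar>cmod d + s / \<epsilon>\<bar>"
      using False by (simp only: norm_mult norm_of_real norm_sgn) simp
    then show ?thesis
      using assms(2,3) by simp
  qed (use e in simp)
  have q: "cmod (q \<zeta> - \<gamma> j) \<le> s" if "\<zeta> \<in> ?B" for \<zeta>
  proof -
    have "cmod (e * (\<zeta> - w 0)) \<le> s / \<epsilon> * \<epsilon>"
      unfolding norm_mult e using that assms(2,3)
      by (intro mult_left_mono) (auto simp: dist_norm norm_minus_commute)
    then show ?thesis
      using assms(2) by (simp add: q_def)
  qed
  \<comment> \<open>The branch avoids \<open>X\<close> while the moving critical value
    \<open>q \<zeta>\<close> stays in \<open>X\<close>, so a holomorphic square root exists on the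
    disc.\<close>
  have nz: "h \<zeta> - q \<zeta> \<noteq> 0" if "\<zeta> \<in> ?B" for \<zeta>
    using crit[OF j q[OF that]] h(2) that by (metis DiffD2 image_subset_iff right_minus_eq)
  have "(\<lambda>\<zeta>. h \<zeta> - q \<zeta>) holomorphic_on ?B"
    unfolding q_def by (intro holomorphic_intros h)
  then obtain g0 where g0: "g0 holomorphic_on ?B" "\<And>\<zeta>. \<zeta> \<in> ?B \<Longrightarrow> h \<zeta> - q \<zeta> = (g0 \<zeta>)\<^sup>2"
    using contractible_imp_holomorphic_sqrt[of _ ?B] nz
    by (metis (no_types, lifting) convex_ball convex_imp_contractible)
  have w0: "w 0 \<in> ?B"
    using assms(2) by simp
  have "(g0 (w 0))\<^sup>2 = (w (Suc j))\<^sup>2"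
    using g0(2)[OF w0] w[OF j] h(3) by (simp add: q_def)
  then have sign: "g0 (w 0) = w (Suc j) \<or> g0 (w 0) = - w (Suc j)"
    by (simp add: power2_eq_iff)
  obtain g where g: "g holomorphic_on ?B" "\<And>\<zeta>. \<zeta> \<in> ?B \<Longrightarrow> h \<zeta> - q \<zeta> = (g \<zeta>)\<^sup>2"
    "g (w 0) = w (Suc j)"
  proof (cases "g0 (w 0) = w (Suc j)")
    case False
    with sign g0 show ?thesis
      by (intro that[of "\<lambda>\<zeta>. - g0 \<zeta>"]) (auto intro!: holomorphic_intros)
  qed (use g0 that in blast)
  have wnz: "w (Suc j) \<noteq> 0"
    using nz[OF w0] g(2)[OF w0] g(3) by auto
  obtain \<delta> where \<delta>: "(g has_field_derivative \<delta>) (at (w 0))"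
    using holomorphic_on_imp_differentiable_at[OF g(1) open_ball w0]
    unfolding field_differentiable_def by blast
  have "((\<lambda>\<zeta>. (g \<zeta>)\<^sup>2) has_field_derivative d - e) (at (w 0))"
  proof (rule has_field_derivative_transform_within_open[OF _ open_ball w0])
    show "((\<lambda>\<zeta>. h \<zeta> - q \<zeta>) has_field_derivative d - e) (at (w 0))"
      unfolding q_def by (auto intro!: derivative_eq_intros h(4))
  qed (use g(2) in auto)
  moreover have "((\<lambda>\<zeta>. (g \<zeta>)\<^sup>2) has_field_derivative 2 * g (w 0) * \<delta>) (at (w 0))"
    by (auto intro!: derivative_eq_intros \<delta>)
  ultimately have "2 * w (Suc j) * \<delta> = d - e"
    using DERIV_unique g(3) by metis
  then have "2 * cmod (w (Suc j)) * cmod \<delta> = cmod d + s / \<epsilon>"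
    by (metis de norm_mult norm_numeral)
  then have "cmod \<delta> = b (Suc j)"
    using wnz by (simp add: b h(5) field_simps)
  moreover have "g ` ?B \<subseteq> cball 0 R - X"
  proof (clarify, rule DiffI)
    fix \<zeta> assume \<zeta>: "\<zeta> \<in> ?B"
    have "h \<zeta> \<in> cball 0 R - X"
      using h(2) \<zeta> by blast
    then have h\<zeta>: "h \<zeta> = (g \<zeta>)\<^sup>2 + q \<zeta>" "h \<zeta> \<notin> X" "cmod (h \<zeta>) \<le> R"
      using g(2)[OF \<zeta>] by (simp_all add: diff_eq_eq)
    show "g \<zeta> \<notin> X"
      using inv[OF j q[OF \<zeta>]] h\<zeta> by metis
    have "(cmod (g \<zeta>))\<^sup>2 = cmod (h \<zeta> - q \<zeta>)"
      using g(2)[OF \<zeta>] by (simp add: norm_power)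
    also have "\<dots> \<le> cmod (h \<zeta>) + cmod (q \<zeta>)"
      by (rule norm_triangle_ineq4)
    also have "\<dots> \<le> R + R"
      using h\<zeta>(3) q[OF \<zeta>] R(3)[OF j] norm_triangle_sub[of "q \<zeta>" "\<gamma> j"] by simp
    \<comment> \<open>For \<open>R \<ge> 2\<close> the disc of radius \<open>R\<close> contains the
      preimages of its points.\<close>
    also have "\<dots> \<le> R\<^sup>2"
      using R(1) by (simp add: power2_eq_square)
    finally have "cmod (g \<zeta>) \<le> R"
      using R(1) by (simp add: abs_le_square_iff[symmetric])
    then show "g \<zeta> \<in> cball 0 R"
      by simp
  qed
  ultimately show ?case
    using g \<delta> by blast
qed

text \<open>Derivatives of inverse branches are reciprocals of multipliers, so their uniform bound
  turns into a lower bound for the product: constant for \<open>s = 0\<close>, growing linearly in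
  \<open>n\<close> for \<open>s > 0\<close>.\<close>

lemma backward_multiplier_bound:
  fixes \<gamma> w :: "nat \<Rightarrow> complex" and X :: "complex set"
  assumes disj: "ball (w 0) \<epsilon> \<inter> X = {}" and "\<epsilon> > 0" "s \<ge> 0"
    and w: "\<And>i. i < n \<Longrightarrow> w i = (w (Suc i))\<^sup>2 + \<gamma> i"
    and crit: "\<And>i c'. i < n \<Longrightarrow> cmod (c' - \<gamma> i) \<le> s \<Longrightarrow> c' \<in> X"
    and inv: "\<And>i c' x. i < n \<Longrightarrow> cmod (c' - \<gamma> i) \<le> s \<Longrightarrow> x \<in> X \<Longrightarrow> x\<^sup>2 + c' \<in> X"
    and R: "R \<ge> 2" "cmod (w 0) + \<epsilon> \<le> R" "\<And>i. i < n \<Longrightarrow> cmod (\<gamma> i) + s \<le> R"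
  shows "1 + s / \<epsilon> / (2 * R) * n / (2 * R / \<epsilon>) \<le> 2 * R / \<epsilon> * (\<Prod>i<n. 2 * cmod (w (Suc i)))"
proof -
  define b where "b = rec_nat 1 (\<lambda>i y. (y + s / \<epsilon>) / (2 * cmod (w (Suc i))))"
  have b: "b 0 = 1" "\<And>i. b (Suc i) = (b i + s / \<epsilon>) / (2 * cmod (w (Suc i)))"
    by (simp_all add: b_def)
  have fam: "\<exists>h d. h holomorphic_on ball (w 0) \<epsilon> \<and> h ` ball (w 0) \<epsilon> \<subseteq> cball 0 R - X \<and>
           h (w 0) = w j \<and> (h has_field_derivative d) (at (w 0)) \<and> cmod d = b j" if "j \<le> n" for j
    by (rule backward_family[OF assms b that])
  have bM: "b j \<le> 2 * R / \<epsilon>" if j: "j \<le> n" for j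
  proof -
    obtain h d where h: "h holomorphic_on ball (w 0) \<epsilon>" "h ` ball (w 0) \<epsilon> \<subseteq> cball 0 R - X"
      "(h has_field_derivative d) (at (w 0))" "cmod d = b j"
      using fam[OF j] by blast
    then show ?thesis
      using deriv_bound_ball[OF h(1) assms(2) _ h(3), of R] by (auto simp: image_subset_iff)
  qed
  have wR: "w j \<in> cball 0 R - X" if "j \<le> n" for j
    using fam[OF that] assms(2) by (metis centre_in_ball image_subset_iff)
  have wnz: "w (Suc i) \<noteq> 0" if "i < n" for i
    using w[OF that] crit[OF that, of "\<gamma> i"] assms(3) wR[of i] that by auto
  \<comment> \<open>Since the backward orbit stays in the disc of radius \<open>R\<close>, the gain
    per step is at least \<open>s / \<epsilon> / (2 * R)\<close>, independently of
    \<open>i\<close>.\<close>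
  have step: "1 / (2 * cmod (w (Suc i))) * b i + s / \<epsilon> / (2 * R) \<le> b (Suc i)" if "i < n" for i
  proof -
    have "s / \<epsilon> / (2 * R) \<le> s / \<epsilon> / (2 * cmod (w (Suc i)))"
      using wR[of "Suc i"] wnz[OF that] that assms(2,3) R(1) by (intro divide_left_mono) auto
    then show ?thesis
      by (simp add: b add_divide_distrib)
  qed
  have "(\<Prod>i<n. 1 / (2 * cmod (w (Suc i)))) * (1 + s / \<epsilon> / (2 * R) * n / (2 * R / \<epsilon>)) \<le> b n"
    using assms(2,3) R(1) step by (intro affine_recurrence_bound) (auto simp: b bM)
  also have "\<dots> \<le> 2 * R / \<epsilon>"
    by (rule bM) simp
  finally have *: "(1 + s / \<epsilon> / (2 * R) * n / (2 * R / \<epsilon>)) / (\<Prod>i<n. 2 * cmod (w (Suc i))) \<le> 2 * R / \<epsilon>"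
    by (simp add: prod_dividef)
  have "(\<Prod>i<n. 2 * cmod (w (Suc i))) > 0"
    using wnz by (intro prod_pos) auto
  with * show ?thesis
    by (simp only: pos_divide_le_eq)
qed

section \<open>Invariant sets of the semigroup\<close>

lemma G_invariant_quad:
  assumes "G_invariant c r L" "cmod (c' - c) \<le> r" "x \<in> L"
  shows "x\<^sup>2 + c' \<in> L"
  using assms semigroup_G.gen[of c' c r] unfolding G_invariant_def
  by (metis image_subset_iff quad_def)

text \<open>A point \<open>y\<close> of the ball is the image of \<open>x\<close> under the
  generator with parameter \<open>y - x^2\<close>, which is still within \<open>r\<close> of
  \<open>c\<close>.\<close>

lemma invariant_contains_ball:
  assumes "G_invariant c r L" "x \<in> L" "cmod (c' - c) + s \<le> r"
  shows "ball (x\<^sup>2 + c') s \<subseteq> L"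
proof
  fix y assume y: "y \<in> ball (x\<^sup>2 + c') s"
  have "cmod (y - x\<^sup>2 - c) \<le> cmod (y - (x\<^sup>2 + c')) + cmod (c' - c)"
    using norm_triangle_ineq[of "y - (x\<^sup>2 + c')" "c' - c"] by (simp add: algebra_simps)
  then have "cmod ((y - x\<^sup>2) - c) \<le> r"
    using y assms(3) by (simp add: dist_norm norm_minus_commute)
  from G_invariant_quad[OF assms(1) this assms(2)] show "y \<in> L"
    by simp
qed

lemma superattracting_imp_zero_in_invariant:
  assumes "superattracting c" "G_invariant c r L" "compact L" "L \<noteq> {}" "r > 0"
  shows "0 \<in> L"
proof (rule ccontr)
  assume "0 \<notin> L"
  obtain p where p: "p \<ge> 1" "(quad c ^^ p) 0 = 0"
    using assms(1) by (auto simp: superattracting_def)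
  define A where "A = (\<lambda>i. (quad c ^^ i) 0) ` {..<p}"
  have A_inv: "x\<^sup>2 + c \<in> A" if xA: "x \<in> A" for x
  proof -
    obtain i where i: "i < p" "x = (quad c ^^ i) 0"
      using xA by (auto simp: A_def)
    then have x: "x\<^sup>2 + c = (quad c ^^ Suc i) 0"
      by (simp add: quad_def)
    show ?thesis
    proof (cases "Suc i = p")
      case True
      then show ?thesis
        using x p by (auto simp: A_def intro!: image_eqI[of _ _ 0])
    next
      case False
      then show ?thesis
        unfolding x A_def using i by (intro imageI) auto
    qed
  qed
  have "0 \<in> A"
    using p by (auto simp: A_def intro!: image_eqI[of _ _ 0])
  then have "c \<in> A"
    using A_inv[of 0] by simp
  have L_iter: "(quad c ^^ i) x \<in> L" if "x \<in> L" for i x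
    using that G_invariant_quad[OF assms(2), of c] assms(5)
    by (induction i) (auto simp: quad_def)
  \<comment> \<open>Any point of the cycle lying in \<open>L\<close> would be carried to 0 by the
    rest of the cycle.\<close>
  have "A \<inter> L = {}"
  proof (rule ccontr)
    assume "A \<inter> L \<noteq> {}"
    then obtain i where i: "i < p" "(quad c ^^ i) 0 \<in> L"
      by (auto simp: A_def)
    from L_iter[OF i(2), of "p - i"] have "(quad c ^^ (p - i + i)) 0 \<in> L"
      by (simp only: funpow_add o_apply)
    with i p \<open>0 \<notin> L\<close> show False
      by simp
  qed
  moreover have "finite A"
    by (simp add: A_def)
  ultimately obtain \<delta> where \<delta>: "\<delta> > 0" "\<And>x y. x \<in> L \<Longrightarrow> y \<in> A \<Longrightarrow> \<delta> \<le> dist x y"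
    using separate_compact_closed[OF assms(3), of A] by (metis finite_imp_closed inf_commute)
  obtain R0 where R0: "\<And>x. x \<in> L \<Longrightarrow> cmod x \<le> R0"
    using compact_imp_bounded[OF assms(3)] bounded_iff by blast
  define R where "R = max 2 (max (cmod c) R0) + \<delta>"
  have R: "R \<ge> 2" "cmod c \<le> R" "\<And>x. x \<in> L \<Longrightarrow> cmod x + \<delta> \<le> R"
    using R0 \<delta>(1) by (force simp: R_def)+
  obtain x where "x \<in> L"
    using assms(4) by blast
  \<comment> \<open>Starting at an image under the central map gives a whole disc of radius
    \<open>r\<close> about \<open>z\<close> inside \<open>L\<close>.\<close>
  define z where "z = x\<^sup>2 + c"
  define w where "w = quad_orbit (\<lambda>_. c) z"
  have ball: "ball z r \<subseteq> L"
    unfolding z_def using \<open>x \<in> L\<close> by (intro invariant_contains_ball[OF assms(2)]) auto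
  have wL: "w i \<in> L" for i
  proof (induction i)
    case 0
    show ?case
      using ball assms(5) by (auto simp: w_def)
  next
    case (Suc i)
    then show ?case
      using G_invariant_quad[OF assms(2), of c "w i"] assms(5) by (simp add: w_def)
  qed
  define \<Lambda> where "\<Lambda> n = (\<Prod>i<n. 2 * cmod (w i))" for n
  have upper: "\<Lambda> n * (1 + n / (2 * R / r)) \<le> 2 * R / r" for n
  proof -
    have "cmod y \<le> R" if "y \<in> L" for y
      using R(3)[OF that] \<delta>(1) by simp
    then show ?thesis
      using forward_multiplier_bound[of z r L r "\<lambda>_. c" R n] ball assms(5) G_invariant_quad[OF assms(2)]
      by (simp add: \<Lambda>_def w_def)
  qed
  have lower: "1 \<le> 2 * R / \<delta> * \<Lambda> n" for n
  proof -
    \<comment> \<open>The orbit is read backwards from \<open>w n\<close>, with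
      \<open>s = 0\<close>: the cycle \<open>A\<close> is invariant under \<open>quad c\<close>, so
      the parameter stays at \<open>c\<close>.\<close>
    have "1 + 0 / \<delta> / (2 * R) * n / (2 * R / \<delta>) \<le> 2 * R / \<delta> * (\<Prod>i<n. 2 * cmod (w (n - Suc i)))"
    proof (rule backward_multiplier_bound[where w = "\<lambda>i. w (n - i)" and X = A and \<gamma> = "\<lambda>_. c"])
      show "ball (w (n - 0)) \<delta> \<inter> A = {}"
        using \<delta>(2)[OF wL[of n]] by (auto simp: not_less[symmetric])
      show "w (n - i) = (w (n - Suc i))\<^sup>2 + c" if "i < n" for i
        using that quad_orbit.simps(2)[of "\<lambda>_. c" z "n - Suc i"] by (simp add: w_def Suc_diff_Suc)
    qed (use \<delta>(1) R wL \<open>c \<in> A\<close> A_inv in auto)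
    moreover have "(\<Prod>i<n. 2 * cmod (w (n - Suc i))) = \<Lambda> n"
      unfolding \<Lambda>_def by (rule prod.nat_diff_reindex)
    ultimately show ?thesis
      by simp
  qed
  have pos: "2 * R / r > 0" "2 * R / \<delta> > 0"
    using R(1) assms(5) \<delta>(1) by auto
  obtain n :: nat where n: "2 * R / r * (2 * R / \<delta> * (2 * R / r)) < n"
    using reals_Archimedean2 by blast
  have "1 + n / (2 * R / r) \<le> 2 * R / \<delta> * \<Lambda> n * (1 + n / (2 * R / r))"
    using mult_right_mono[OF lower[of n], of "1 + n / (2 * R / r)"] R(1) assms(5) by simp
  also have "\<dots> \<le> 2 * R / \<delta> * (2 * R / r)"
    using mult_left_mono[OF upper[of n], of "2 * R / \<delta>"] pos(2) by (simp only: mult.assoc less_imp_le)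
  finally have "n / (2 * R / r) < 2 * R / \<delta> * (2 * R / r)"
    by simp
  with n pos(1) show False
    by (simp only: pos_divide_less_eq mult.commute less_asym)
qed

lemma invariant_no_multiplier_one:
  assumes L: "G_invariant c r L" "compact L" "0 \<in> L"
    and s: "s > 0" "\<And>i. cmod (\<gamma> i - c) + s \<le> r"
    and per: "n \<ge> 1" "\<And>i. \<gamma> (i + n) = \<gamma> i" "quad_orbit \<gamma> z n = z"
  shows "(\<Prod>i<n. 2 * quad_orbit \<gamma> z i) \<noteq> 1"
proof
  assume one: "(\<Prod>i<n. 2 * quad_orbit \<gamma> z i) = 1"
  have "(\<Prod>i<n. 2 * cmod (quad_orbit \<gamma> z i)) = cmod (\<Prod>i<n. 2 * quad_orbit \<gamma> z i)"
    by (simp only: norm_mult norm_numeral flip: prod_norm)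
  \<comment> \<open>Over any number of periods the modulus stays 1, which neither decay nor linear
    growth permits.\<close>
  then have one': "(\<Prod>i<m * n. 2 * cmod (quad_orbit \<gamma> z i)) = 1" for m
    using prod_periodic[of "\<lambda>i. 2 * cmod (quad_orbit \<gamma> z i)" n m] orbit_periodic[OF per(2,3)] one
    by simp
  have near: "cmod (c' - c) \<le> r" if "cmod (c' - \<gamma> i) \<le> s" for c' i
    using norm_triangle_ineq[of "c' - \<gamma> i" "\<gamma> i - c"] that s(2)[of i] by simp
  have crit: "c' \<in> L" if "cmod (c' - \<gamma> i) \<le> s" for c' i
    using G_invariant_quad[OF L(1) near[OF that] L(3)] by simp
  have inv: "x\<^sup>2 + c' \<in> L" if "cmod (c' - \<gamma> i) \<le> s" "x \<in> L" for c' i x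
    using G_invariant_quad[OF L(1) near[OF that(1)] that(2)] .
  obtain R0 where R0: "\<And>x. x \<in> L \<Longrightarrow> cmod x \<le> R0"
    using compact_imp_bounded[OF L(2)] bounded_iff by blast
  show False
  proof (cases "z \<in> L")
    case True
    define R where "R = max 1 R0"
    have R: "R > 0" "\<And>x. x \<in> L \<Longrightarrow> cmod x \<le> R"
      using R0 by (force simp: R_def)+
    have "quad_orbit \<gamma> z i \<in> L" for i
      using True s(1) inv[of "\<gamma> j" j for j] by (induction i) auto
    \<comment> \<open>By periodicity \<open>z\<close> is itself an image of a point of
      \<open>L\<close>, so moving the last parameter by less than \<open>s\<close> fills a disc
      about \<open>z\<close>.\<close>
    moreover have "z = (quad_orbit \<gamma> z (n - 1))\<^sup>2 + \<gamma> (n - 1)"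
      using per(1,3) quad_orbit.simps(2)[of \<gamma> z "n - 1"] by simp
    ultimately have ball: "ball z s \<subseteq> L"
      using invariant_contains_ball[OF L(1) _ s(2)] by metis
    obtain m :: nat where m: "2 * R / s * (2 * R / s) < m"
      using reals_Archimedean2 by blast
    have "(\<Prod>i<m * n. 2 * cmod (quad_orbit \<gamma> z i)) * (1 + s / s * (m * n) / (2 * R / s)) \<le> 2 * R / s"
      using forward_multiplier_bound[of z s L s \<gamma> R "m * n"] ball s(1) inv R(2) by simp
    then have "(m * n) / (2 * R / s) < 2 * R / s"
      using s(1) by (simp add: one')
    then have "real (m * n) < 2 * R / s * (2 * R / s)"
      using R(1) s(1) by (subst (asm) pos_divide_less_eq) simp_all
    moreover have "real m \<le> real (m * n)"
      using per(1) by (simp flip: of_nat_mult)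
    ultimately show False
      using m by linarith
  next
    case False
    then obtain \<epsilon> where \<epsilon>: "\<epsilon> > 0" "ball z \<epsilon> \<inter> L = {}"
      using compact_imp_closed[OF L(2)] open_contains_ball[of "- L"]
      by (metis ComplI closed_def disjoint_eq_subset_Compl)
    define R where "R = max 2 (max (cmod c + r) (cmod z + \<epsilon>))"
    have "cmod (\<gamma> i) + s \<le> R" for i
      using norm_triangle_sub[of "\<gamma> i" c] s(2)[of i] by (simp add: R_def)
    then have R: "R \<ge> 2" "cmod z + \<epsilon> \<le> R" "\<And>i. cmod (\<gamma> i) + s \<le> R"
      by (auto simp: R_def)
    define \<kappa> where "\<kappa> = s / \<epsilon> / (2 * R)"
    have \<kappa>: "\<kappa> > 0"
      using s(1) \<epsilon>(1) R(1) by (simp add: \<kappa>_def)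
    obtain m :: nat where m: "2 * R / \<epsilon> * (2 * R / \<epsilon>) / \<kappa> < m"
      using reals_Archimedean2 by blast
    have zm: "quad_orbit \<gamma> z (m * n) = z"
      using orbit_periodic[OF per(2,3)] by (induction m) (simp_all add: add.commute[of n])
    \<comment> \<open>The periodic orbit serves as its own backward orbit, ending \<open>m\<close>
      periods later at \<open>z\<close>. As \<open>0 \<in> L\<close>, every parameter used is a
      critical value in \<open>L\<close>, so \<open>L\<close> can play the role of
      \<open>X\<close>.\<close>
    have "1 + s / \<epsilon> / (2 * R) * (m * n) / (2 * R / \<epsilon>)
            \<le> 2 * R / \<epsilon> * (\<Prod>i<m * n. 2 * cmod (quad_orbit \<gamma> z (m * n - Suc i)))"
    proof (rule backward_multiplier_bound[where w = "\<lambda>i. quad_orbit \<gamma> z (m * n - i)" and X = L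
          and \<gamma> = "\<lambda>i. \<gamma> (m * n - Suc i)"])
      show "quad_orbit \<gamma> z (m * n - i) = (quad_orbit \<gamma> z (m * n - Suc i))\<^sup>2 + \<gamma> (m * n - Suc i)"
        if "i < m * n" for i
        using that quad_orbit.simps(2)[of \<gamma> z "m * n - Suc i"] by (simp add: Suc_diff_Suc)
    qed (use \<epsilon> s(1) R crit inv zm in auto)
    also have "(\<Prod>i<m * n. 2 * cmod (quad_orbit \<gamma> z (m * n - Suc i))) = 1"
      using one'[of m] prod.nat_diff_reindex[of "\<lambda>i. 2 * cmod (quad_orbit \<gamma> z i)" "m * n"] by simp
    finally have "\<kappa> * (m * n) / (2 * R / \<epsilon>) < 2 * R / \<epsilon>"
      by (simp add: \<kappa>_def)
    then have "\<kappa> * (m * n) < 2 * R / \<epsilon> * (2 * R / \<epsilon>)"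
      using R(1) \<epsilon>(1) by (subst (asm) pos_divide_less_eq) simp_all
    then have "real (m * n) < 2 * R / \<epsilon> * (2 * R / \<epsilon>) / \<kappa>"
      using \<kappa> by (subst pos_less_divide_eq) (simp_all add: mult.commute)
    moreover have "real m \<le> real (m * n)"
      using per(1) by (simp flip: of_nat_mult)
    ultimately show False
      using m by linarith
  qed
qed

theorem theorem4p20:
  fixes c \<rho>0 :: complex and N k :: nat and p :: "nat \<Rightarrow> nat"
  assumes "superattracting c"
    and "N \<ge> 1" and "k \<ge> 1"
    and "\<forall>i\<in>{1..N}. p i < k"
    and "discriminant
           (comp_poly (map (\<lambda>i. c + \<rho>0 * exp (2 * pi * \<i> / of_nat k) ^ p i) [1..<N+1])
              - [:0, 1:]) = 0"
  shows "r_bif c \<le> ereal (cmod \<rho>0)"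
proof -
  \<comment> \<open>The periodic continuation of the parameters; \<open>Suc\<close> translates from
    indices starting at 0 to those of \<open>p\<close> starting at 1.\<close>
  define \<gamma> where "\<gamma> i = c + \<rho>0 * exp (2 * pi * \<i> / of_nat k) ^ p (Suc (i mod N))" for i
  have "cmod (exp (2 * pi * \<i> / of_nat k)) = 1"
    by simp
  then have dist: "cmod (\<gamma> i - c) = cmod \<rho>0" for i
    by (simp add: \<gamma>_def norm_mult norm_power)
  have "map (\<lambda>i. c + \<rho>0 * exp (2 * pi * \<i> / of_nat k) ^ p i) [1..<N+1] = map \<gamma> [0..<N]"
    by (rule nth_equalityI) (simp_all add: \<gamma>_def del: upt_Suc)
  then obtain z where z: "quad_orbit \<gamma> z N = z" "(\<Prod>i<N. 2 * quad_orbit \<gamma> z i) = 1"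
    using comp_poly_discriminant_zero[of N \<gamma>] assms(2,5) by metis
  have "r \<le> cmod \<rho>0" if "has_planar_minimal_set c r" for r
  proof (rule ccontr)
    assume "\<not> r \<le> cmod \<rho>0"
    \<comment> \<open>All \<open>\<gamma> i\<close> lie on the circle of radius
      \<open>cmod \<rho>0\<close> about \<open>c\<close>, so \<open>r - cmod \<rho>0\<close> is the
      room left for perturbing them.\<close>
    then have r: "r - cmod \<rho>0 > 0" "r > 0"
      using norm_ge_zero[of \<rho>0] by linarith+
    obtain L where L: "L \<noteq> {}" "compact L" "G_invariant c r L"
      using \<open>has_planar_minimal_set c r\<close>
      by (auto simp: has_planar_minimal_set_def planar_minimal_set_def)
    have "0 \<in> L"
      using superattracting_imp_zero_in_invariant[OF assms(1) L(3,2,1) r(2)] .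
    then have "(\<Prod>i<N. 2 * quad_orbit \<gamma> z i) \<noteq> 1"
      using invariant_no_multiplier_one[OF L(3,2) _ r(1) _ assms(2) _ z(1)] dist
      by (simp add: \<gamma>_def)
    with z(2) show False
      by simp
  qed
  then show ?thesis
    unfolding r_bif_def by (intro Sup_least) auto
qed

end
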